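(* Let $\mathbb{K}$ be $\mathbb{R}$, $\mathbb{C}$ or $\mathbb{H}$ (the real numbers, complex numbers or quaternions). An inner product space over $\mathbb{K}$ is a Hilbert space (i.e. complete in its norm) if and only if it is orthogonally complete.
   Context: Inner product spaces over $\mathbb{K}$ are right $\mathbb{K}$-vector spaces $X$ with an inner product $\langle\cdot,\cdot\rangle\colon X\times X\to\mathbb{K}$ satisfying $\langle x, y\lambda+z\rangle=\langle x,y\rangle\lambda+\langle x,z\rangle$, $\langle x,y\rangle^*=\langle y,x\rangle$ (where $*$ is conjugation in $\mathbb{K}$), $\langle x,x\rangle\ge 0$, and $\langle x,x\rangle=0\Rightarrow x=0$; the norm is $\|x\|=\sqrt{\langle x,x\rangle}$. A family $(x_j)_{j\in J}$ in $X$ is orthogonal if $\langle x_j,x_k\rangle=0$ for $j\neq k$. An $\ell^2$-family in $X$ is an orthogonal family $(x_j)_{j\in J}$ (indexed by any set $J$) for which the real numbers $\sum_{j\in F}\|x_j\|^2$, with $F$ ranging over the finite subsets of $J$, are bounded above. An order sum of an orthogonal family $(x_j)_{j\in J}$ is an element $s\in X$ such that $\langle s,x_j\rangle=\langle x_j,x_j\rangle$ for each $j\in J$, and $\langle s,s\rangle=\sup_F\sum_{j\in F}\langle x_j,x_j\rangle$, where $F$ ranges over the finite subsets of $J$. $X$ is orthogonally complete if every $\ell^2$-family in $X$ has an order sum. *)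

theory Defs
  imports "HOL-Analysis.Analysis"
begin

section \<open>Quaternions\<close>

codatatype quat = Quat (qRe: real) (qI: real) (qJ: real) (qK: real)

lemma quat_eq_iff:
  "x = y \<longleftrightarrow> qRe x = qRe y \<and> qI x = qI y \<and> qJ x = qJ y \<and> qK x = qK y"
  by (auto intro: quat.expand)

instantiation quat :: ab_group_add
begin

primcorec zero_quat where
  "qRe 0 = 0" | "qI 0 = 0" | "qJ 0 = 0" | "qK 0 = 0"

primcorec plus_quat where
  "qRe (x + y) = qRe x + qRe y"
| "qI (x + y) = qI x + qI y"
| "qJ (x + y) = qJ x + qJ y"
| "qK (x + y) = qK x + qK y"

primcorec uminus_quat where
  "qRe (- x) = - qRe x"
| "qI (- x) = - qI x"
| "qJ (- x) = - qJ x"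
| "qK (- x) = - qK x"

primcorec minus_quat where
  "qRe (x - y) = qRe x - qRe y"
| "qI (x - y) = qI x - qI y"
| "qJ (x - y) = qJ x - qJ y"
| "qK (x - y) = qK x - qK y"

instance
  by standard (simp_all add: quat_eq_iff)

end

instantiation quat :: ring_1
begin

primcorec one_quat where
  "qRe 1 = 1" | "qI 1 = 0" | "qJ 1 = 0" | "qK 1 = 0"

primcorec times_quat where
  "qRe (x * y) = qRe x * qRe y - qI x * qI y - qJ x * qJ y - qK x * qK y"
| "qI (x * y) = qRe x * qI y + qI x * qRe y + qJ x * qK y - qK x * qJ y"
| "qJ (x * y) = qRe x * qJ y - qI x * qK y + qJ x * qRe y + qK x * qI y"
| "qK (x * y) = qRe x * qK y + qI x * qJ y - qJ x * qI y + qK x * qRe y"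

instance
  by standard (simp_all add: quat_eq_iff algebra_simps)

end

primcorec qcnj :: "quat \<Rightarrow> quat" where
  "qRe (qcnj x) = qRe x"
| "qI (qcnj x) = - qI x"
| "qJ (qcnj x) = - qJ x"
| "qK (qcnj x) = - qK x"

instantiation quat :: real_algebra_1
begin

primcorec scaleR_quat where
  "qRe (scaleR r x) = r * qRe x"
| "qI (scaleR r x) = r * qI x"
| "qJ (scaleR r x) = r * qJ x"
| "qK (scaleR r x) = r * qK x"

instance
  by standard (simp_all add: quat_eq_iff algebra_simps)

end

lemma quat_of_real [simp]:
  "qRe (of_real r) = r" "qI (of_real r) = 0" "qJ (of_real r) = 0" "qK (of_real r) = 0"
  by (simp_all add: of_real_def)

instantiation quat :: real_normed_div_algebra
begin

definition norm_quat_def: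
  "norm x = sqrt ((qRe x)\<^sup>2 + (qI x)\<^sup>2 + (qJ x)\<^sup>2 + (qK x)\<^sup>2)"

definition inverse_quat_def: "inverse x = qcnj x /\<^sub>R (norm x)\<^sup>2"

definition divide_quat_def: "x div y = x * inverse y" for x y :: quat

definition sgn_quat_def: "sgn x = x /\<^sub>R norm x" for x :: quat

definition dist_quat_def: "dist x y = norm (x - y)" for x y :: quat

definition uniformity_quat_def:
  "(uniformity :: (quat \<times> quat) filter) = (INF e\<in>{0 <..}. principal {(x, y). dist x y < e})"

definition open_quat_def:
  "open (U :: quat set) \<longleftrightarrow> (\<forall>x\<in>U. eventually (\<lambda>(x', y). x' = x \<longrightarrow> y \<in> U) uniformity)"

instance
proof
  fix r :: real and x y :: quat
  have n2: "(norm z)\<^sup>2 = (qRe z)\<^sup>2 + (qI z)\<^sup>2 + (qJ z)\<^sup>2 + (qK z)\<^sup>2" for z :: quat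
    by (simp add: norm_quat_def)
  have pair: "norm z = norm ((qRe z, qI z), (qJ z, qK z))" for z
    by (simp add: norm_quat_def norm_Pair add.assoc)
  show eq0: "(norm z = 0) = (z = 0)" for z :: quat
    by (simp add: pair quat_eq_iff zero_prod_def)
  show "norm (x + y) \<le> norm x + norm y"
    unfolding pair
    by (rule order_trans[OF _ norm_triangle_ineq]) simp
  show "norm (scaleR r x) = \<bar>r\<bar> * norm x"
    by (simp add: norm_quat_def power_mult_distrib distrib_left [symmetric] real_sqrt_mult)
  show "norm (x * y) = norm x * norm y"
    unfolding norm_quat_def real_sqrt_mult [symmetric]
    by (rule arg_cong[where f = sqrt]) (simp add: power2_eq_square algebra_simps)
  show "inverse x * x = 1" "x * inverse x = 1" if "x \<noteq> 0"
  proof -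
    have "(norm x)\<^sup>2 \<noteq> 0"
      using that eq0 by simp
    then show "inverse x * x = 1" "x * inverse x = 1"
      unfolding inverse_quat_def n2
      by (simp_all add: quat_eq_iff divide_simps) (simp_all add: power2_eq_square algebra_simps)
  qed
  show "inverse (0 :: quat) = 0"
    by (simp add: inverse_quat_def quat_eq_iff)
qed (rule divide_quat_def sgn_quat_def dist_quat_def open_quat_def uniformity_quat_def)+

end


section \<open>Real division algebras with conjugation\<close>

text \<open>A common interface to the three scalar domains; conjugation reverses products.\<close>

class conj_div_algebra = real_normed_div_algebra +
  fixes conjg :: "'a \<Rightarrow> 'a"
  assumes conjg_add: "conjg (a + b) = conjg a + conjg b"
    and conjg_mult: "conjg (a * b) = conjg b * conjg a"
    and conjg_conjg [simp]: "conjg (conjg a) = a"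
    and conjg_mult_scaleR: "conjg a * a = ((norm a)\<^sup>2) *\<^sub>R 1"

lemma conjg_mult_self: "conjg a * a = of_real ((norm a)\<^sup>2)"
  for a :: "'a::conj_div_algebra"
  unfolding of_real_def by (rule conjg_mult_scaleR)

instantiation real :: conj_div_algebra
begin
definition conjg_real_def: "conjg a = a" for a :: real
instance
  by standard (simp_all add: conjg_real_def power2_eq_square)
end

instantiation complex :: conj_div_algebra
begin
definition conjg_complex_def: "conjg a = cnj a" for a :: complex
instance
  by standard (simp_all add: conjg_complex_def complex_eq_iff cmod_def power2_eq_square)
end

instantiation quat :: conj_div_algebra
begin
definition conjg_quat_def: "conjg a = qcnj a" for a :: quat
instance
  by standard
    (simp_all add: conjg_quat_def quat_eq_iff norm_quat_def power2_eq_square algebra_simps)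
end


section \<open>Inner product spaces\<close>

text \<open>Scalars act on the right: \<open>smul x a\<close> is $x a$.\<close>

locale inner_product_space =
  fixes smul :: "'a::ab_group_add \<Rightarrow> 'k::conj_div_algebra \<Rightarrow> 'a"
    and ip :: "'a \<Rightarrow> 'a \<Rightarrow> 'k"
  assumes smul_add_left: "smul (x + y) a = smul x a + smul y a"
    and smul_add_right: "smul x (a + b) = smul x a + smul x b"
    and smul_mult: "smul x (a * b) = smul (smul x a) b"
    and smul_one: "smul x 1 = x"
    and ip_linear_right: "ip x (smul y a + z) = ip x y * a + ip x z"
    and ip_conj: "conjg (ip x y) = ip y x"
    and ip_nonneg: "\<exists>r\<ge>0. ip x x = of_real r"
    and ip_definite: "ip x x = 0 \<Longrightarrow> x = 0"

text \<open>As \<open>ip x x\<close> is a nonnegative real scalar, \<open>norm (ip x x)\<close> is that real number.\<close>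

definition ip_norm :: "('a \<Rightarrow> 'a \<Rightarrow> 'k::conj_div_algebra) \<Rightarrow> 'a \<Rightarrow> real" where
  "ip_norm ip x = sqrt (norm (ip x x))"

definition hilbert_space ::
    "('a::ab_group_add \<Rightarrow> 'k::conj_div_algebra \<Rightarrow> 'a) \<Rightarrow> ('a \<Rightarrow> 'a \<Rightarrow> 'k) \<Rightarrow> bool" where
  "hilbert_space smul ip \<longleftrightarrow>
     inner_product_space smul ip \<and> Metric_space.mcomplete UNIV (\<lambda>x y. ip_norm ip (x - y))"

definition orthogonal_family ::
    "('a \<Rightarrow> 'a \<Rightarrow> 'k::conj_div_algebra) \<Rightarrow> 'i set \<Rightarrow> ('i \<Rightarrow> 'a) \<Rightarrow> bool" where
  "orthogonal_family ip J x \<longleftrightarrow> pairwise (\<lambda>j k. ip (x j) (x k) = 0) J"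

definition l2_family ::
    "('a \<Rightarrow> 'a \<Rightarrow> 'k::conj_div_algebra) \<Rightarrow> 'i set \<Rightarrow> ('i \<Rightarrow> 'a) \<Rightarrow> bool" where
  "l2_family ip J x \<longleftrightarrow> orthogonal_family ip J x \<and>
     bdd_above ((\<lambda>F. \<Sum>j\<in>F. (ip_norm ip (x j))\<^sup>2) ` {F. finite F \<and> F \<subseteq> J})"

text \<open>The real number \<open>\<langle>x\<^sub>j, x\<^sub>j\<rangle>\<close> under the supremum is \<open>(ip_norm ip (x j))\<^sup>2\<close>. A supremum
  in the reals exists only if the finite partial sums are bounded.\<close>

definition order_sum ::
    "('a \<Rightarrow> 'a \<Rightarrow> 'k::conj_div_algebra) \<Rightarrow> 'i set \<Rightarrow> ('i \<Rightarrow> 'a) \<Rightarrow> 'a \<Rightarrow> bool" where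
  "order_sum ip J x s \<longleftrightarrow>
     (\<forall>j\<in>J. ip s (x j) = ip (x j) (x j)) \<and>
     bdd_above ((\<lambda>F. \<Sum>j\<in>F. (ip_norm ip (x j))\<^sup>2) ` {F. finite F \<and> F \<subseteq> J}) \<and>
     ip s s = of_real (SUP F\<in>{F. finite F \<and> F \<subseteq> J}. \<Sum>j\<in>F. (ip_norm ip (x j))\<^sup>2)"

text \<open>HOL formulas cannot quantify over types, so the type from which the index sets are
  drawn is a parameter. Up to bijections of the index set and members equal to \<open>0\<close>, every
  orthogonal family is indexed by a subset of the space itself, since its nonzero members
  are distinct. Hence \<open>orthogonally_complete TYPE('a) ip\<close>, where \<open>'a\<close> is the type of the
  space, already entails \<open>orthogonally_complete TYPE('i) ip\<close> for all index types \<open>'i\<close>.\<close>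

definition orthogonally_complete ::
    "'i itself \<Rightarrow> ('a \<Rightarrow> 'a \<Rightarrow> 'k::conj_div_algebra) \<Rightarrow> bool" where
  "orthogonally_complete _ ip \<longleftrightarrow>
     (\<forall>(J :: 'i set) x. l2_family ip J x \<longrightarrow> (\<exists>s. order_sum ip J x s))"


subsection \<open>The distance of an inner product space is a metric\<close>

context inner_product_space
begin

lemma smul_zero: "smul x 0 = 0"
  using smul_add_right[of x 0 0] by simp

lemma smul_minus_one: "smul x (- 1) = - x"
proof -
  have "smul x (- 1) + smul x 1 = 0"
    by (simp add: smul_add_right[symmetric] smul_zero)
  then show ?thesis
    by (simp add: smul_one eq_neg_iff_add_eq_0)
qed

lemma ip_add_right: "ip x (y + z) = ip x y + ip x z"
  using ip_linear_right[of x y 1 z] by (simp add: smul_one)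

lemma ip_zero_right [simp]: "ip x 0 = 0"
  using ip_add_right[of x 0 0] by simp

lemma ip_smul_right: "ip x (smul y a) = ip x y * a"
  using ip_linear_right[of x y a 0] by simp

lemma ip_minus_right: "ip x (- y) = - ip x y"
  by (metis smul_minus_one ip_smul_right mult_minus1_right)

lemma ip_add_left: "ip (x + y) z = ip x z + ip y z"
  by (metis ip_conj ip_add_right conjg_add)

lemma ip_zero_left [simp]: "ip 0 x = 0"
  using ip_add_left[of 0 0 x] by simp

lemma ip_minus_left: "ip (- x) y = - ip x y"
proof -
  have "ip (- x) y + ip x y = 0"
    by (simp add: ip_add_left[symmetric])
  then show ?thesis
    by (simp add: eq_neg_iff_add_eq_0)
qed

lemma ip_self: "ip x x = of_real ((ip_norm ip x)\<^sup>2)"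
  using ip_nonneg[of x] by (auto simp: ip_norm_def)

lemma ip_norm_nonneg: "0 \<le> ip_norm ip x"
  by (simp add: ip_norm_def)

lemma ip_norm_eq_0: "ip_norm ip x = 0 \<longleftrightarrow> x = 0"
  using ip_definite by (auto simp: ip_norm_def)

lemma ip_norm_minus: "ip_norm ip (- x) = ip_norm ip x"
  by (simp add: ip_norm_def ip_minus_left ip_minus_right)

lemma Cauchy_Schwarz: "norm (ip x y) \<le> ip_norm ip x * ip_norm ip y"
proof (cases "y = 0")
  case True
  then show ?thesis by (simp add: ip_norm_def)
next
  case False
  define N where "N = (ip_norm ip y)\<^sup>2"
  have N: "N > 0" using False by (simp add: N_def ip_norm_eq_0)
  have yy: "ip y y = of_real N" by (simp only: N_def ip_self)
  define a where "a = ip y x /\<^sub>R N"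
  define z where "z = x + smul y (- a)"
  have yz: "ip y z = 0"
    using N by (simp add: z_def ip_add_right ip_smul_right yy a_def of_real_def)
  have sm: "ip (smul y (- a)) z = 0"
  proof -
    have "ip z (smul y (- a)) = ip z y * (- a)" by (rule ip_smul_right)
    also have "ip z y = 0"
      by (metis yz ip_conj ip_zero_left ip_zero_right)
    finally show ?thesis
      by (metis mult_zero_left ip_conj ip_zero_left ip_zero_right)
  qed
  have "ip z z = ip x z"
  proof -
    have "ip z z = ip x z + ip (smul y (- a)) z"
      by (subst (1) z_def) (rule ip_add_left)
    then show ?thesis by (simp add: sm)
  qed
  also have "\<dots> = ip x x - ip x y * ip y x /\<^sub>R N"
    by (simp add: z_def ip_add_right ip_smul_right a_def)
  also have "ip x y * ip y x = of_real ((norm (ip y x))\<^sup>2)"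
    by (metis conjg_mult_self ip_conj)
  finally have "of_real ((ip_norm ip z)\<^sup>2) =
      (of_real ((ip_norm ip x)\<^sup>2 - (norm (ip y x))\<^sup>2 / N) :: 'k)"
    unfolding ip_self by (simp add: scaleR_conv_of_real divide_inverse mult.commute)
  then have "(ip_norm ip z)\<^sup>2 = (ip_norm ip x)\<^sup>2 - (norm (ip y x))\<^sup>2 / N"
    by (simp only: of_real_eq_iff)
  then have "0 \<le> (ip_norm ip x)\<^sup>2 - (norm (ip y x))\<^sup>2 / N"
    by (metis zero_le_power2)
  then have "(norm (ip y x))\<^sup>2 \<le> (ip_norm ip x * ip_norm ip y)\<^sup>2"
    using N by (simp add: N_def field_simps power_mult_distrib)
  then have le: "norm (ip y x) \<le> ip_norm ip x * ip_norm ip y"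
    by (rule power2_le_imp_le) (simp add: ip_norm_nonneg)
  have "norm (ip x y) = norm (ip y x)"
  proof (cases "ip y x = 0")
    case True
    then show ?thesis by (metis ip_conj ip_zero_left ip_zero_right)
  next
    case False
    have "norm (ip x y) * norm (ip y x) = norm (conjg (ip y x) * ip y x)"
      by (simp add: norm_mult ip_conj)
    also have "\<dots> = norm (ip y x) * norm (ip y x)"
      by (simp only: conjg_mult_self) (simp add: power2_eq_square norm_mult)
    finally show ?thesis using False by simp
  qed
  with le show ?thesis by simp
qed

lemma ip_norm_triangle: "ip_norm ip (x + y) \<le> ip_norm ip x + ip_norm ip y"
proof -
  have "(ip_norm ip (x + y))\<^sup>2 = norm (ip x x + ip x y + (ip y x + ip y y))"
    by (simp add: ip_norm_def ip_add_left ip_add_right add_ac)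
  also have "\<dots> \<le> norm (ip x x) + norm (ip x y) + (norm (ip y x) + norm (ip y y))"
    by (meson norm_triangle_le norm_triangle_ineq add_mono order_trans)
  also have "\<dots> \<le> (ip_norm ip x + ip_norm ip y)\<^sup>2"
    using Cauchy_Schwarz[of x y] Cauchy_Schwarz[of y x]
    by (simp add: power2_sum ip_norm_def algebra_simps)
  finally show ?thesis
    by (rule power2_le_imp_le) (simp add: ip_norm_nonneg)
qed

lemma Metric_space_ip: "Metric_space UNIV (\<lambda>x y. ip_norm ip (x - y))"
proof
  fix x y z :: 'a
  show "0 \<le> ip_norm ip (x - y)" by (rule ip_norm_nonneg)
  show "ip_norm ip (x - y) = ip_norm ip (y - x)"
    using ip_norm_minus[of "x - y"] by simp
  show "(ip_norm ip (x - y) = 0) = (x = y)" by (simp add: ip_norm_eq_0)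
  show "ip_norm ip (x - z) \<le> ip_norm ip (x - y) + ip_norm ip (y - z)"
    using ip_norm_triangle[of "x - y" "y - z"] by simp
qed

end

end

theory Submission
  imports Defs
begin

text \<open>
  An order sum \<open>s\<close> of an orthogonal family \<open>x\<close> is its sum in norm, because
  \<open>\<parallel>s - (\<Sum>j\<in>F. x j)\<parallel>\<^sup>2 = \<parallel>s\<parallel>\<^sup>2 - (\<Sum>j\<in>F. \<parallel>x j\<parallel>\<^sup>2)\<close> for every finite \<open>F\<close>. Orthogonal
  completeness therefore says that \<open>\<ell>\<^sup>2\<close>-families converge in norm.

  If the space is complete, choose finite sets \<open>F n\<close> whose sums \<open>\<Sum>j\<in>F n. \<parallel>x j\<parallel>\<^sup>2\<close> approach
  the supremum. The partial sums of \<open>x\<close> over \<open>F n\<close> form a Cauchy sequence, and its limit is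
  an order sum.

  Conversely, in an orthogonally complete space take a maximal orthonormal set \<open>E\<close> by Zorn's
  lemma. By Bessel's inequality the family \<open>e \<langle>e, y\<rangle>\<close> is an \<open>\<ell>\<^sup>2\<close>-family for each vector \<open>y\<close>;
  its order sum has the same coordinates as \<open>y\<close>, hence equals \<open>y\<close> by maximality, which gives
  Parseval's identity. For a Cauchy sequence, the coordinates converge, since the scalars are
  complete, and the limits of the coordinates are again the coordinates of a vector. Parseval's
  identity turns the coordinatewise convergence, uniform on finite subsets of \<open>E\<close>,
  into convergence in norm. So the space is an \<open>\<ell>\<^sup>2(E)\<close>, and completeness follows as it does there.
\<close>

section \<open>The scalars\<close>

lemma conjg_zero [simp]: "conjg 0 = (0 :: 'k::conj_div_algebra)"
  using conjg_add[of 0 "0 :: 'k"] by simp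

lemma conjg_of_real [simp]: "conjg (of_real r) = (of_real r :: 'k::conj_div_algebra)"
proof (cases "r = 0")
  case False
  have "conjg (of_real r) * of_real r = (of_real r * of_real r :: 'k)"
    by (simp add: conjg_mult_self power2_eq_square)
  with False show ?thesis by simp
qed simp

lemma complete_UNIV_quat: "complete (UNIV :: quat set)"
  unfolding complete_def
proof safe
  fix f :: "nat \<Rightarrow> quat"
  assume f: "Cauchy f"
  have bound: "\<bar>qRe z\<bar> \<le> norm z" "\<bar>qI z\<bar> \<le> norm z" "\<bar>qJ z\<bar> \<le> norm z" "\<bar>qK z\<bar> \<le> norm z"
    for z
    by (auto simp: norm_quat_def intro!: real_le_rsqrt)
  have conv: "convergent (\<lambda>n. p (f n))"
    if p: "\<And>z. \<bar>p z\<bar> \<le> norm z" "\<And>y z. p (y - z) = p y - p z" for p :: "quat \<Rightarrow> real"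
  proof -
    have "Cauchy (\<lambda>n. p (f n))"
    proof (rule CauchyI)
      fix e :: real assume "0 < e"
      then obtain N where N: "norm (f m - f n) < e" if "m \<ge> N" "n \<ge> N" for m n
        using CauchyD[OF f] by blast
      have "norm (p (f m) - p (f n)) < e" if "m \<ge> N" "n \<ge> N" for m n
        using N[OF that] p(1)[of "f m - f n"] p(2)[of "f m" "f n"] by simp
      then show "\<exists>M. \<forall>m\<ge>M. \<forall>n\<ge>M. norm (p (f m) - p (f n)) < e" by blast
    qed
    then show ?thesis by (rule Cauchy_convergent)
  qed
  obtain a b c d where lim: "(\<lambda>n. qRe (f n)) \<longlonglongrightarrow> a" "(\<lambda>n. qI (f n)) \<longlonglongrightarrow> b"
      "(\<lambda>n. qJ (f n)) \<longlonglongrightarrow> c" "(\<lambda>n. qK (f n)) \<longlonglongrightarrow> d"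
    using conv[OF bound(1)] conv[OF bound(2)] conv[OF bound(3)] conv[OF bound(4)]
    by (auto simp: convergent_def)
  have "(\<lambda>n. norm (f n - Quat a b c d)) \<longlonglongrightarrow> sqrt ((a - a)\<^sup>2 + (b - b)\<^sup>2 + (c - c)\<^sup>2 + (d - d)\<^sup>2)"
    unfolding norm_quat_def minus_quat.sel quat.sel by (intro tendsto_intros lim)
  then have "f \<longlonglongrightarrow> Quat a b c d"
    by (simp add: tendsto_norm_zero_iff flip: LIM_zero_iff[of f])
  then show "\<exists>l\<in>UNIV. f \<longlonglongrightarrow> l" by blast
qed


section \<open>Sums of orthogonal families\<close>

context inner_product_space
begin

lemma ip_diff_right: "ip x (y - z) = ip x y - ip x z"
  using ip_add_right[of x y "- z"] by (simp add: ip_minus_right)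

lemma ip_diff_left: "ip (x - y) z = ip x z - ip y z"
  using ip_add_left[of x "- y" z] by (simp add: ip_minus_left)

lemma ip_smul_left: "ip (smul x a) y = conjg a * ip x y"
  by (metis ip_conj ip_smul_right conjg_mult)

lemma ip_sum_right: "ip x (sum f F) = (\<Sum>j\<in>F. ip x (f j))"
  by (induction F rule: infinite_finite_induct) (simp_all add: ip_add_right)

lemma ip_sum_left: "ip (sum f F) x = (\<Sum>j\<in>F. ip (f j) x)"
  by (induction F rule: infinite_finite_induct) (simp_all add: ip_add_left)

lemma ip_eq_0_commute: "ip x y = 0 \<longleftrightarrow> ip y x = 0"
  by (metis ip_conj conjg_zero)

lemma ip_norm_sq_diff:
  assumes "ip x y = of_real c"
  shows "(ip_norm ip (x - y))\<^sup>2 = (ip_norm ip x)\<^sup>2 - 2 * c + (ip_norm ip y)\<^sup>2"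
proof -
  have "ip y x = of_real c"
    by (metis assms ip_conj conjg_of_real)
  then have "ip (x - y) (x - y) = ip x x - of_real c - (of_real c - ip y y)"
    using assms by (simp add: ip_diff_left ip_diff_right)
  then have "(ip_norm ip (x - y))\<^sup>2 = (ip_norm ip x)\<^sup>2 - c - (c - (ip_norm ip y)\<^sup>2)"
    by (simp only: ip_self of_real_diff[symmetric] of_real_eq_iff)
  then show ?thesis by simp
qed

lemma ip_norm_smul: "ip_norm ip (smul x a) = ip_norm ip x * norm a"
proof -
  have "norm (conjg a) * norm a = norm a * norm a"
    using arg_cong[OF conjg_mult_self[of a], of norm]
    by (simp add: norm_mult power2_eq_square)
  then have "norm (conjg a) = norm a" by (cases "a = 0") simp_all
  then have "norm (ip (smul x a) (smul x a)) = norm (ip x x) * (norm a)\<^sup>2"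
    by (simp add: ip_smul_left ip_smul_right norm_mult power2_eq_square mult_ac)
  then show ?thesis by (simp add: ip_norm_def real_sqrt_mult)
qed

lemma ip_sum_sum_orthogonal:
  assumes x: "orthogonal_family ip J x"
    and F: "finite F" "F \<subseteq> J" and G: "finite G" "G \<subseteq> J"
  shows "ip (sum x F) (sum x G) = of_real (\<Sum>j\<in>F \<inter> G. (ip_norm ip (x j))\<^sup>2)"
proof -
  have "ip (x j) (sum x G) = (if j \<in> G then of_real ((ip_norm ip (x j))\<^sup>2) else 0)"
    if "j \<in> F" for j
  proof -
    have "ip (x j) (x k) = (if j = k then of_real ((ip_norm ip (x j))\<^sup>2) else 0)" if "k \<in> G" for k
      using x F G \<open>j \<in> F\<close> that
      unfolding orthogonal_family_def pairwise_def by (auto simp: ip_self simp del: of_real_power)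
    then have "ip (x j) (sum x G) =
        (\<Sum>k\<in>G. if j = k then of_real ((ip_norm ip (x j))\<^sup>2) else 0)"
      unfolding ip_sum_right by (rule sum.cong[OF refl])
    then show ?thesis using G by simp
  qed
  then have "ip (sum x F) (sum x G) =
      (\<Sum>j\<in>F. if j \<in> G then of_real ((ip_norm ip (x j))\<^sup>2) else 0)"
    unfolding ip_sum_left by (rule sum.cong[OF refl])
  then show ?thesis
    unfolding sum.inter_restrict[OF F(1)] of_real_sum by (auto intro!: sum.cong)
qed

lemma ip_norm_sq_sum_orthogonal:
  assumes "orthogonal_family ip J x" "finite F" "F \<subseteq> J"
  shows "(ip_norm ip (sum x F))\<^sup>2 = (\<Sum>j\<in>F. (ip_norm ip (x j))\<^sup>2)"
proof -
  have "of_real ((ip_norm ip (sum x F))\<^sup>2) = (of_real (\<Sum>j\<in>F. (ip_norm ip (x j))\<^sup>2) :: 'k)"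
    using ip_sum_sum_orthogonal[OF assms(1-3) assms(2,3)] by (simp only: ip_self Int_absorb)
  then show ?thesis by (simp only: of_real_eq_iff)
qed

text \<open>An order sum is a norm limit of finite partial sums, so whatever is orthogonal to all
  members of the family is orthogonal to its order sum.\<close>

lemma order_sum_orthogonal:
  assumes x: "orthogonal_family ip J x" and s: "order_sum ip J x s"
    and y: "\<And>j. j \<in> J \<Longrightarrow> ip (x j) y = 0"
  shows "ip s y = 0"
proof -
  let ?q = "\<lambda>F. \<Sum>j\<in>F. (ip_norm ip (x j))\<^sup>2"
  let ?FF = "{F. finite F \<and> F \<subseteq> J}"
  have bdd: "bdd_above (?q ` ?FF)" using s by (simp add: order_sum_def)
  have "of_real ((ip_norm ip s)\<^sup>2) = (of_real (SUP F\<in>?FF. ?q F) :: 'k)"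
    using s by (simp only: order_sum_def ip_self)
  then have ss: "(ip_norm ip s)\<^sup>2 = (SUP F\<in>?FF. ?q F)" by (simp only: of_real_eq_iff)
  have "norm (ip s y) \<le> e * ip_norm ip y" if "e > 0" for e
  proof -
    have "(SUP F\<in>?FF. ?q F) - e\<^sup>2 < (SUP F\<in>?FF. ?q F)" using that by simp
    then obtain F where F: "F \<in> ?FF" "(SUP F\<in>?FF. ?q F) - e\<^sup>2 < ?q F"
      using less_cSUP_iff[OF _ bdd] by (metis (no_types, lifting) empty_iff finite.emptyI
          empty_subsetI mem_Collect_eq)
    have "ip s (sum x F) = of_real (?q F)"
      using s F(1) by (auto simp: order_sum_def ip_sum_right ip_self subset_iff intro!: sum.cong)
    then have "(ip_norm ip (s - sum x F))\<^sup>2 = (ip_norm ip s)\<^sup>2 - ?q F"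
      using ip_norm_sq_sum_orthogonal[OF x, of F] F(1) by (simp only: ip_norm_sq_diff) simp
    with F(2) ss have "(ip_norm ip (s - sum x F))\<^sup>2 \<le> e\<^sup>2" by simp
    then have le: "ip_norm ip (s - sum x F) \<le> e"
      by (rule power2_le_imp_le) (use that in simp)
    have "ip (sum x F) y = 0"
      using F(1) y by (auto simp: ip_sum_left subset_iff intro!: sum.neutral)
    then have "norm (ip s y) = norm (ip (s - sum x F) y)" by (simp add: ip_diff_left)
    also have "\<dots> \<le> ip_norm ip (s - sum x F) * ip_norm ip y" by (rule Cauchy_Schwarz)
    also have "\<dots> \<le> e * ip_norm ip y" by (rule mult_right_mono[OF le ip_norm_nonneg])
    finally show ?thesis .
  qed
  then have "\<forall>\<^sub>F e in at_right 0. norm (ip s y) \<le> e * ip_norm ip y"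
    by (simp add: eventually_at_right_less[THEN eventually_mono])
  moreover have "((\<lambda>e. e * ip_norm ip y) \<longlongrightarrow> 0) (at_right 0)"
    by (rule tendsto_mult_left_zero) (rule tendsto_ident_at)
  ultimately have "norm (ip s y) \<le> 0"
    by (intro tendsto_lowerbound[of _ _ "at_right (0::real)"]) simp_all
  then show ?thesis by simp
qed


section \<open>Completeness in the norm implies orthogonal completeness\<close>

text \<open>Completeness of the metric space, spelled out with the norm.\<close>

lemma mcomplete_iff:
  "Metric_space.mcomplete UNIV (\<lambda>x y. ip_norm ip (x - y)) \<longleftrightarrow>
    (\<forall>\<sigma> :: nat \<Rightarrow> 'a. (\<forall>\<epsilon>>0. \<exists>N. \<forall>m\<ge>N. \<forall>n\<ge>N. ip_norm ip (\<sigma> m - \<sigma> n) < \<epsilon>) \<longrightarrow>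
      (\<exists>l. \<forall>\<epsilon>>0. \<exists>N. \<forall>n\<ge>N. ip_norm ip (\<sigma> n - l) < \<epsilon>))"
proof -
  interpret Metric_space UNIV "\<lambda>x y. ip_norm ip (x - y)" by (rule Metric_space_ip)
  have "MCauchy \<sigma> \<longleftrightarrow> (\<forall>\<epsilon>>0. \<exists>N. \<forall>m\<ge>N. \<forall>n\<ge>N. ip_norm ip (\<sigma> m - \<sigma> n) < \<epsilon>)" for \<sigma>
    unfolding MCauchy_def by auto
  moreover have "limitin mtopology \<sigma> l sequentially \<longleftrightarrow>
      (\<forall>\<epsilon>>0. \<exists>N. \<forall>n\<ge>N. ip_norm ip (\<sigma> n - l) < \<epsilon>)" for \<sigma> l
    unfolding limit_metric_sequentially by simp
  ultimately show ?thesis unfolding mcomplete_def by simp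
qed

lemma hilbert_imp_order_sum:
  assumes complete: "Metric_space.mcomplete UNIV (\<lambda>x y. ip_norm ip (x - y))"
    and x: "l2_family ip J x"
  shows "\<exists>s. order_sum ip J x s"
proof -
  let ?q = "\<lambda>F. \<Sum>j\<in>F. (ip_norm ip (x j))\<^sup>2"
  let ?FF = "{F. finite F \<and> F \<subseteq> J}"
  define S where "S = (SUP F\<in>?FF. ?q F)"
  have orth: "orthogonal_family ip J x" and bdd: "bdd_above (?q ` ?FF)"
    using x by (simp_all add: l2_family_def)
  have le_S: "?q F \<le> S" if "F \<in> ?FF" for F
    unfolding S_def by (rule cSUP_upper[OF that bdd])
  have "\<exists>F\<in>?FF. S - 1 / real (Suc n) < ?q F" for n
  proof -
    have "S - 1 / real (Suc n) < (SUP F\<in>?FF. ?q F)" by (simp add: S_def)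
    then show ?thesis using less_cSUP_iff[OF _ bdd] by blast
  qed
  then have "\<exists>F. \<forall>n. F n \<in> ?FF \<and> S - 1 / real (Suc n) < ?q (F n)"
    by (intro choice) blast
  then obtain F where F: "F n \<in> ?FF" and near: "S - 1 / real (Suc n) < ?q (F n)" for n
    by blast
  define \<sigma> where "\<sigma> n = sum x (F n)" for n
  have dist: "(ip_norm ip (\<sigma> m - \<sigma> n))\<^sup>2 < 2 / real (Suc N)" if "m \<ge> N" "n \<ge> N" for m n N
  proof -
    have fin: "finite (F m)" "finite (F n)" "F m \<subseteq> J" "F n \<subseteq> J" using F by auto
    have "(ip_norm ip (\<sigma> m - \<sigma> n))\<^sup>2 = ?q (F m) - 2 * ?q (F m \<inter> F n) + ?q (F n)"
      unfolding \<sigma>_def ip_norm_sq_sum_orthogonal[OF orth fin(1,3), symmetric]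
        ip_norm_sq_sum_orthogonal[OF orth fin(2,4), symmetric]
      by (rule ip_norm_sq_diff) (rule ip_sum_sum_orthogonal[OF orth fin(1,3,2,4)])
    \<comment> \<open>In terms of the union only an upper bound is needed, which is \<open>S\<close>.\<close>
    also have "?q (F m \<inter> F n) = ?q (F m) + ?q (F n) - ?q (F m \<union> F n)"
      using sum.union_inter[OF fin(1,2), of "\<lambda>j. (ip_norm ip (x j))\<^sup>2"] by simp
    finally have "(ip_norm ip (\<sigma> m - \<sigma> n))\<^sup>2 = 2 * ?q (F m \<union> F n) - ?q (F m) - ?q (F n)"
      by simp
    moreover have "?q (F m \<union> F n) \<le> S" using fin by (intro le_S) simp
    moreover have "1 / real (Suc m) \<le> 1 / real (Suc N)" "1 / real (Suc n) \<le> 1 / real (Suc N)"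
      using that by (auto simp: field_simps)
    moreover have "2 / real (Suc N) = 1 / real (Suc N) + 1 / real (Suc N)" by simp
    ultimately show ?thesis using near[of m] near[of n] by linarith
  qed
  have "\<exists>N. \<forall>m\<ge>N. \<forall>n\<ge>N. ip_norm ip (\<sigma> m - \<sigma> n) < \<epsilon>" if "\<epsilon> > 0" for \<epsilon>
  proof -
    have "0 < \<epsilon>\<^sup>2 / 2" using that by simp
    then obtain N where N: "inverse (real (Suc N)) < \<epsilon>\<^sup>2 / 2"
      using reals_Archimedean by blast
    have "ip_norm ip (\<sigma> m - \<sigma> n) < \<epsilon>" if "m \<ge> N" "n \<ge> N" for m n
    proof (rule power2_less_imp_less)
      show "(ip_norm ip (\<sigma> m - \<sigma> n))\<^sup>2 < \<epsilon>\<^sup>2"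
        using dist[OF that] N by (simp add: inverse_eq_divide)
    qed (use \<open>\<epsilon> > 0\<close> in simp)
    then show ?thesis by blast
  qed
  then obtain s where "\<forall>\<epsilon>>0. \<exists>N. \<forall>n\<ge>N. ip_norm ip (\<sigma> n - s) < \<epsilon>"
    using complete unfolding mcomplete_iff by blast
  then have lim: "(\<lambda>n. ip_norm ip (\<sigma> n - s)) \<longlonglongrightarrow> 0"
    by (simp add: LIMSEQ_def ip_norm_nonneg)
  have small: "(\<lambda>n. 1 / real (Suc n)) \<longlonglongrightarrow> 0"
    using LIMSEQ_inverse_real_of_nat by (simp add: inverse_eq_divide)
  have "ip s (x j) = ip (x j) (x j)" if "j \<in> J" for j
  proof -
    have "(\<lambda>n. ip (\<sigma> n) (x j)) \<longlonglongrightarrow> ip s (x j)"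
    proof (rule LIM_zero_cancel, rule Lim_null_comparison)
      show "\<forall>\<^sub>F n in sequentially. norm (ip (\<sigma> n) (x j) - ip s (x j))
          \<le> ip_norm ip (\<sigma> n - s) * ip_norm ip (x j)"
        using Cauchy_Schwarz by (simp flip: ip_diff_left)
      show "(\<lambda>n. ip_norm ip (\<sigma> n - s) * ip_norm ip (x j)) \<longlonglongrightarrow> 0"
        by (rule tendsto_mult_left_zero[OF lim])
    qed
    moreover have "(\<lambda>n. ip (\<sigma> n) (x j)) \<longlonglongrightarrow> ip (x j) (x j)"
    proof (rule LIM_zero_cancel, rule Lim_null_comparison[OF _ small], rule always_eventually, rule)
      fix n
      have fin: "finite (F n)" "F n \<subseteq> J" using F by auto
      have ip: "ip (\<sigma> n) (x j) = of_real (?q (F n \<inter> {j}))"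
        unfolding \<sigma>_def using ip_sum_sum_orthogonal[OF orth fin, of "{j}"] that by simp
      \<comment> \<open>A member left out of \<open>F n\<close> has small norm, because adding it keeps the sum below \<open>S\<close>.\<close>
      show "norm (ip (\<sigma> n) (x j) - ip (x j) (x j)) \<le> 1 / real (Suc n)"
      proof (cases "j \<in> F n")
        case True
        then show ?thesis using ip by (simp add: ip_self)
      next
        case False
        have "?q (insert j (F n)) \<le> S" using fin that by (intro le_S) simp
        then have "(ip_norm ip (x j))\<^sup>2 \<le> 1 / real (Suc n)"
          using near[of n] False fin by simp
        then show ?thesis using ip False by (simp add: ip_self norm_power)
      qed
    qed
    ultimately show ?thesis by (rule LIMSEQ_unique)
  qed
  moreover have "ip s s = of_real S"
  proof -
    have "(\<lambda>n. ip_norm ip (\<sigma> n)) \<longlonglongrightarrow> ip_norm ip s"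
    proof (rule LIM_zero_cancel, rule Lim_null_comparison[OF _ lim], rule always_eventually, rule)
      fix n
      show "norm (ip_norm ip (\<sigma> n) - ip_norm ip s) \<le> ip_norm ip (\<sigma> n - s)"
        using ip_norm_triangle[of "\<sigma> n - s" s] ip_norm_triangle[of "s - \<sigma> n" "\<sigma> n"]
          ip_norm_minus[of "\<sigma> n - s"] by simp
    qed
    then have "(\<lambda>n. (ip_norm ip (\<sigma> n))\<^sup>2) \<longlonglongrightarrow> (ip_norm ip s)\<^sup>2"
      by (rule tendsto_power)
    moreover have "(\<lambda>n. (ip_norm ip (\<sigma> n))\<^sup>2) \<longlonglongrightarrow> S"
    proof (rule LIM_zero_cancel, rule Lim_null_comparison[OF _ small], rule always_eventually, rule)
      fix n
      have "(ip_norm ip (\<sigma> n))\<^sup>2 = ?q (F n)"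
        unfolding \<sigma>_def using F by (intro ip_norm_sq_sum_orthogonal[OF orth]) auto
      then show "norm ((ip_norm ip (\<sigma> n))\<^sup>2 - S) \<le> 1 / real (Suc n)"
        using near[of n] le_S[OF F[of n]] by simp
    qed
    ultimately have "(ip_norm ip s)\<^sup>2 = S" by (rule LIMSEQ_unique)
    then show ?thesis by (simp only: ip_self)
  qed
  ultimately have "order_sum ip J x s"
    using bdd by (simp add: order_sum_def S_def)
  then show ?thesis ..
qed


section \<open>Orthonormal sets\<close>

text \<open>A set of pairwise orthogonal unit vectors. It serves as its own index set, so the families
  of its multiples are indexed by elements of the space.\<close>

definition orthonormal_set :: "'a set \<Rightarrow> bool" where
  "orthonormal_set E \<longleftrightarrow> pairwise (\<lambda>x y. ip x y = 0) E \<and> (\<forall>e\<in>E. ip e e = 1)"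

lemma exists_maximal_orthonormal_set:
  obtains E where "orthonormal_set E" "\<And>x. (\<And>e. e \<in> E \<Longrightarrow> ip e x = 0) \<Longrightarrow> x = 0"
proof -
  have "\<exists>E\<in>Collect orthonormal_set. \<forall>E'\<in>Collect orthonormal_set. E \<subseteq> E' \<longrightarrow> E' = E"
  proof (rule subset_Zorn_nonempty)
    have "orthonormal_set {}" by (simp add: orthonormal_set_def)
    then show "Collect orthonormal_set \<noteq> {}" by blast
  next
    fix C assume "C \<noteq> {}" and C: "subset.chain (Collect orthonormal_set) C"
    have "pairwise (\<lambda>x y. ip x y = 0) (\<Union>C)"
    proof (rule pairwise_chain_Union)
      show "pairwise (\<lambda>x y. ip x y = 0) E" if "E \<in> C" for E
        using C that by (auto simp: subset.chain_def orthonormal_set_def)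
      show "chain\<^sub>\<subseteq> C"
        using C by (auto simp: subset.chain_def chain_subset_def)
    qed
    moreover have "\<forall>e\<in>\<Union>C. ip e e = 1"
      using C by (auto simp: subset.chain_def orthonormal_set_def)
    ultimately show "\<Union>C \<in> Collect orthonormal_set" by (simp add: orthonormal_set_def)
  qed
  then obtain E where E: "orthonormal_set E"
    and max: "\<And>E'. orthonormal_set E' \<Longrightarrow> E \<subseteq> E' \<Longrightarrow> E' = E"
    by blast
  have "x = 0" if orth: "\<And>e. e \<in> E \<Longrightarrow> ip e x = 0" for x
  proof (rule ccontr)
    assume "x \<noteq> 0"
    define u where "u = smul x (of_real (1 / ip_norm ip x))"
    have "ip_norm ip u = 1"
      using \<open>x \<noteq> 0\<close> by (simp add: u_def ip_norm_smul ip_norm_eq_0 ip_norm_nonneg del: of_real_divide)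
    then have uu: "ip u u = 1" by (simp add: ip_self)
    have eu: "ip e u = 0" "ip u e = 0" if "e \<in> E" for e
    proof -
      show "ip e u = 0" using orth[OF that] by (simp add: u_def ip_smul_right)
      then show "ip u e = 0" by (simp add: ip_eq_0_commute)
    qed
    have "orthonormal_set (insert u E)"
      using E uu eu by (auto simp: orthonormal_set_def pairwise_insert)
    then have "u \<in> E" using max by blast
    with eu(1)[of u] uu show False by simp
  qed
  with E show thesis by (rule that)
qed

lemma orthogonal_family_smul:
  assumes "orthonormal_set E"
  shows "orthogonal_family ip E (\<lambda>e. smul e (a e))"
  using assms
  by (auto simp: orthogonal_family_def orthonormal_set_def pairwise_def ip_smul_left ip_smul_right)

lemma ip_norm_smul_orthonormal:
  assumes "orthonormal_set E" "e \<in> E"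
  shows "ip_norm ip (smul e a) = norm a"
proof -
  have "ip_norm ip e = 1" using assms by (simp add: orthonormal_set_def ip_norm_def)
  then show ?thesis by (simp add: ip_norm_smul)
qed

lemma sum_ip_norm_smul_orthonormal:
  assumes "orthonormal_set E" "F \<subseteq> E"
  shows "(\<Sum>e\<in>F. (ip_norm ip (smul e (a e)))\<^sup>2) = (\<Sum>e\<in>F. (norm (a e))\<^sup>2)"
  using assms by (intro sum.cong) (auto simp: ip_norm_smul_orthonormal)

lemma Bessel_inequality:
  assumes E: "orthonormal_set E" and F: "finite F" "F \<subseteq> E"
  shows "(\<Sum>e\<in>F. (norm (ip e y))\<^sup>2) \<le> (ip_norm ip y)\<^sup>2"
proof -
  let ?p = "\<Sum>e\<in>F. smul e (ip e y)"
  let ?q = "\<Sum>e\<in>F. (norm (ip e y))\<^sup>2"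
  have "ip ?p y = of_real ?q"
    by (simp add: ip_sum_left ip_smul_left conjg_mult_self)
  then have "(ip_norm ip (?p - y))\<^sup>2 = (ip_norm ip ?p)\<^sup>2 - 2 * ?q + (ip_norm ip y)\<^sup>2"
    by (rule ip_norm_sq_diff)
  also have "(ip_norm ip ?p)\<^sup>2 = ?q"
    using ip_norm_sq_sum_orthogonal[OF orthogonal_family_smul[OF E] F]
    by (simp add: sum_ip_norm_smul_orthonormal[OF E F(2)])
  finally have "(ip_norm ip (?p - y))\<^sup>2 = (ip_norm ip y)\<^sup>2 - ?q" by simp
  then show ?thesis using zero_le_power2[of "ip_norm ip (?p - y)"] by linarith
qed

lemma order_sum_coordinate:
  assumes E: "orthonormal_set E" and s: "order_sum ip E (\<lambda>e. smul e (a e)) s" and e: "e \<in> E"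
  shows "ip e s = a e"
proof (cases "a e = 0")
  case True
  \<comment> \<open>The defining equation of an order sum is void at a zero member of the family.\<close>
  have "ip (smul d (a d)) e = 0" if "d \<in> E" for d
    using E e that True by (cases "d = e") (auto simp: orthonormal_set_def pairwise_def ip_smul_left)
  then have "ip s e = 0" by (rule order_sum_orthogonal[OF orthogonal_family_smul[OF E] s])
  with True show ?thesis by (simp add: ip_eq_0_commute)
next
  case False
  have "ip s (smul e (a e)) = ip (smul e (a e)) (smul e (a e))"
    using s e by (simp add: order_sum_def)
  then have "ip s e * a e = conjg (a e) * a e"
    using E e by (simp add: ip_smul_left ip_smul_right orthonormal_set_def)
  with False have "ip s e = conjg (a e)" by simp
  then show ?thesis by (metis ip_conj conjg_conjg)
qed


section \<open>Orthogonal completeness implies completeness in the norm\<close>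

text \<open>A square summable family of coefficients is the coordinate family of some vector.\<close>

lemma orthogonally_complete_coordinates:
  assumes complete: "orthogonally_complete TYPE('a) ip" and E: "orthonormal_set E"
    and B: "\<And>F. finite F \<Longrightarrow> F \<subseteq> E \<Longrightarrow> (\<Sum>e\<in>F. (norm (a e))\<^sup>2) \<le> B"
  obtains s where "order_sum ip E (\<lambda>e. smul e (a e)) s" "\<And>e. e \<in> E \<Longrightarrow> ip e s = a e"
proof -
  have "l2_family ip E (\<lambda>e. smul e (a e))"
    unfolding l2_family_def bdd_above_def
    using orthogonal_family_smul[OF E] B by (auto simp: sum_ip_norm_smul_orthonormal[OF E])
  then obtain s where s: "order_sum ip E (\<lambda>e. smul e (a e)) s"
    using complete unfolding orthogonally_complete_def by blast
  show thesis by (rule that[OF s order_sum_coordinate[OF E s]])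
qed

text \<open>Parseval's identity, in the form of an upper bound for the norm; the reverse inequality
  is Bessel's.\<close>

lemma Parseval_upper_bound:
  assumes complete: "orthogonally_complete TYPE('a) ip" and E: "orthonormal_set E"
    and max: "\<And>x. (\<And>e. e \<in> E \<Longrightarrow> ip e x = 0) \<Longrightarrow> x = 0"
    and B: "\<And>F. finite F \<Longrightarrow> F \<subseteq> E \<Longrightarrow> (\<Sum>e\<in>F. (norm (ip e y))\<^sup>2) \<le> B"
  shows "(ip_norm ip y)\<^sup>2 \<le> B"
proof -
  obtain s where s: "order_sum ip E (\<lambda>e. smul e (ip e y)) s"
    and coord: "\<And>e. e \<in> E \<Longrightarrow> ip e s = ip e y"
    using orthogonally_complete_coordinates[OF complete E, of "\<lambda>e. ip e y"]
      Bessel_inequality[OF E] by blast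
  have "y - s = 0" by (rule max) (simp add: ip_diff_right coord)
  then have "ip y y = of_real (SUP F\<in>{F. finite F \<and> F \<subseteq> E}.
      \<Sum>e\<in>F. (ip_norm ip (smul e (ip e y)))\<^sup>2)"
    using s by (simp add: order_sum_def)
  then have "(ip_norm ip y)\<^sup>2 = (SUP F\<in>{F. finite F \<and> F \<subseteq> E}.
      \<Sum>e\<in>F. (ip_norm ip (smul e (ip e y)))\<^sup>2)"
    by (simp only: ip_self of_real_eq_iff)
  also have "\<dots> \<le> B"
    using B by (intro cSUP_least) (auto simp: sum_ip_norm_smul_orthonormal[OF E])
  finally show ?thesis .
qed

lemma orthogonally_complete_imp_mcomplete:
  assumes scalars: "complete (UNIV :: 'k set)" and complete: "orthogonally_complete TYPE('a) ip"
  shows "Metric_space.mcomplete UNIV (\<lambda>x y. ip_norm ip (x - y))"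
  unfolding mcomplete_iff
proof (intro allI impI)
  fix \<sigma> :: "nat \<Rightarrow> 'a"
  assume Cauchy: "\<forall>\<epsilon>>0. \<exists>N. \<forall>m\<ge>N. \<forall>n\<ge>N. ip_norm ip (\<sigma> m - \<sigma> n) < \<epsilon>"
  obtain E where E: "orthonormal_set E"
    and max: "\<And>x. (\<And>e. e \<in> E \<Longrightarrow> ip e x = 0) \<Longrightarrow> x = 0"
    by (rule exists_maximal_orthonormal_set) blast
  \<comment> \<open>The coordinates converge, because \<open>y \<mapsto> \<langle>e, y\<rangle>\<close> does not increase norms.\<close>
  have "\<exists>l. (\<lambda>n. ip e (\<sigma> n)) \<longlonglongrightarrow> l" if "e \<in> E" for e
  proof -
    have "ip_norm ip e = 1" using E that by (simp add: orthonormal_set_def ip_norm_def)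
    then have "norm (ip e (\<sigma> m) - ip e (\<sigma> n)) \<le> ip_norm ip (\<sigma> m - \<sigma> n)" for m n
      using Cauchy_Schwarz[of e "\<sigma> m - \<sigma> n"] by (simp add: ip_diff_right)
    then have "Cauchy (\<lambda>n. ip e (\<sigma> n))"
      using Cauchy by (intro CauchyI) (meson le_less_trans)
    then show ?thesis using scalars by (auto simp: complete_def)
  qed
  then obtain a where a: "\<And>e. e \<in> E \<Longrightarrow> (\<lambda>n. ip e (\<sigma> n)) \<longlonglongrightarrow> a e" by metis
  have bound: "(\<Sum>e\<in>F. (norm (a e - ip e (\<sigma> n)))\<^sup>2) \<le> \<epsilon>\<^sup>2"
    if F: "finite F" "F \<subseteq> E" and n: "\<And>m. m \<ge> N \<Longrightarrow> ip_norm ip (\<sigma> m - \<sigma> n) < \<epsilon>" for F N n \<epsilon>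
  proof (rule LIMSEQ_le_const2)
    show "(\<lambda>m. \<Sum>e\<in>F. (norm (ip e (\<sigma> m) - ip e (\<sigma> n)))\<^sup>2)
        \<longlonglongrightarrow> (\<Sum>e\<in>F. (norm (a e - ip e (\<sigma> n)))\<^sup>2)"
      using F by (intro tendsto_intros a) auto
    have "(\<Sum>e\<in>F. (norm (ip e (\<sigma> m) - ip e (\<sigma> n)))\<^sup>2) \<le> \<epsilon>\<^sup>2" if "m \<ge> N" for m
    proof -
      have "(\<Sum>e\<in>F. (norm (ip e (\<sigma> m) - ip e (\<sigma> n)))\<^sup>2) \<le> (ip_norm ip (\<sigma> m - \<sigma> n))\<^sup>2"
        using Bessel_inequality[OF E F, of "\<sigma> m - \<sigma> n"] by (simp add: ip_diff_right)
      also have "\<dots> \<le> \<epsilon>\<^sup>2"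
        using n[OF that] by (intro power_mono) (simp_all add: ip_norm_nonneg)
      finally show ?thesis .
    qed
    then show "\<exists>M. \<forall>m\<ge>M. (\<Sum>e\<in>F. (norm (ip e (\<sigma> m) - ip e (\<sigma> n)))\<^sup>2) \<le> \<epsilon>\<^sup>2" by blast
  qed
  \<comment> \<open>The coefficients \<open>a e\<close>, shifted by the coordinates of one late term of the sequence, are
    square summable with bound \<open>1\<close>.\<close>
  obtain N where "\<forall>m\<ge>N. \<forall>n\<ge>N. ip_norm ip (\<sigma> m - \<sigma> n) < 1" using Cauchy zero_less_one by blast
  then have "(\<Sum>e\<in>F. (norm (a e - ip e (\<sigma> N)))\<^sup>2) \<le> 1\<^sup>2" if "finite F" "F \<subseteq> E" for F
    using that by (intro bound) auto
  then obtain t where t: "\<And>e. e \<in> E \<Longrightarrow> ip e t = a e - ip e (\<sigma> N)"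
    using orthogonally_complete_coordinates[OF complete E, of "\<lambda>e. a e - ip e (\<sigma> N)" "1\<^sup>2"]
    by metis
  define s where "s = t + \<sigma> N"
  have s: "ip e s = a e" if "e \<in> E" for e
    using t[OF that] by (simp add: s_def ip_add_right)
  have "\<exists>N. \<forall>n\<ge>N. ip_norm ip (\<sigma> n - s) < \<epsilon>" if "\<epsilon> > 0" for \<epsilon>
  proof -
    have "\<epsilon> / 2 > 0" using that by simp
    then obtain N where N: "\<forall>m\<ge>N. \<forall>n\<ge>N. ip_norm ip (\<sigma> m - \<sigma> n) < \<epsilon> / 2"
      using Cauchy[rule_format, of "\<epsilon> / 2"] by auto
    have "ip_norm ip (\<sigma> n - s) < \<epsilon>" if "n \<ge> N" for n
    proof -
      have "(ip_norm ip (s - \<sigma> n))\<^sup>2 \<le> (\<epsilon> / 2)\<^sup>2"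
      proof (rule Parseval_upper_bound[OF complete E max])
        fix F assume F: "finite F" "F \<subseteq> E"
        have "(\<Sum>e\<in>F. (norm (ip e (s - \<sigma> n)))\<^sup>2) = (\<Sum>e\<in>F. (norm (a e - ip e (\<sigma> n)))\<^sup>2)"
          using F s by (intro sum.cong) (auto simp: ip_diff_right)
        also have "\<dots> \<le> (\<epsilon> / 2)\<^sup>2" using F N that by (intro bound) auto
        finally show "(\<Sum>e\<in>F. (norm (ip e (s - \<sigma> n)))\<^sup>2) \<le> (\<epsilon> / 2)\<^sup>2" .
      qed
      then have "ip_norm ip (s - \<sigma> n) \<le> \<epsilon> / 2"
        by (rule power2_le_imp_le) (use \<open>\<epsilon> > 0\<close> in simp)
      then show ?thesis using \<open>\<epsilon> > 0\<close> ip_norm_minus[of "s - \<sigma> n"] by simp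
    qed
    then show ?thesis by blast
  qed
  then show "\<exists>l. \<forall>\<epsilon>>0. \<exists>N. \<forall>n\<ge>N. ip_norm ip (\<sigma> n - l) < \<epsilon>" by blast
qed

end


section \<open>The characterization of Hilbert spaces\<close>

lemma hilbert_space_iff_orthogonally_complete:
  fixes smul :: "'a::ab_group_add \<Rightarrow> 'k::conj_div_algebra \<Rightarrow> 'a"
  assumes "inner_product_space smul ip" "complete (UNIV :: 'k set)"
  shows "hilbert_space smul ip \<longleftrightarrow>
    orthogonally_complete TYPE('a) ip \<and> orthogonally_complete TYPE('i) ip"
proof -
  interpret inner_product_space smul ip by fact
  show ?thesis
    using assms orthogonally_complete_imp_mcomplete
    unfolding hilbert_space_def
    by (auto simp: orthogonally_complete_def intro: hilbert_imp_order_sum)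
qed

theorem proposition4p9:
  fixes smul_R :: "'a::ab_group_add \<Rightarrow> real \<Rightarrow> 'a" and ip_R :: "'a \<Rightarrow> 'a \<Rightarrow> real"
    and smul_C :: "'b::ab_group_add \<Rightarrow> complex \<Rightarrow> 'b" and ip_C :: "'b \<Rightarrow> 'b \<Rightarrow> complex"
    and smul_H :: "'c::ab_group_add \<Rightarrow> quat \<Rightarrow> 'c" and ip_H :: "'c \<Rightarrow> 'c \<Rightarrow> quat"
  shows
    "(inner_product_space smul_R ip_R \<longrightarrow>
       (hilbert_space smul_R ip_R \<longleftrightarrow>
          orthogonally_complete TYPE('a) ip_R \<and> orthogonally_complete TYPE('i) ip_R)) \<and>
     (inner_product_space smul_C ip_C \<longrightarrow>
       (hilbert_space smul_C ip_C \<longleftrightarrow>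
          orthogonally_complete TYPE('b) ip_C \<and> orthogonally_complete TYPE('i) ip_C)) \<and>
     (inner_product_space smul_H ip_H \<longrightarrow>
       (hilbert_space smul_H ip_H \<longleftrightarrow>
          orthogonally_complete TYPE('c) ip_H \<and> orthogonally_complete TYPE('i) ip_H))"
  using hilbert_space_iff_orthogonally_complete complete_UNIV complete_UNIV_quat
  by metis

end
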